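(* For each Platonic solid ($n=4,6,8,12,20$) with circumradius $R>0$ and centroid $O$, and for any point $M$ of the space with $L=|MO|$, $$R^2=\frac12\left(S_{[n]}^{(2)}\pm\sqrt{4\left(S_{[n]}^{(2)}\right)^2-3S_{[n]}^{(4)}}\right),\qquad L^2=\frac12\left(S_{[n]}^{(2)}\mp\sqrt{4\left(S_{[n]}^{(2)}\right)^2-3S_{[n]}^{(4)}}\right),$$ where the signs correspond: either both upper signs hold or both lower signs hold.
   Context: The Platonic solid with $n$ vertices is the regular tetrahedron ($n=4$), regular octahedron ($n=6$), cube ($n=8$), regular icosahedron ($n=12$) or regular dodecahedron ($n=20$). For such a solid in Euclidean $3$-space with vertices $A_1,\dots,A_n$ and a point $M$ of the space, put $d_i=|MA_i|$ and $S_{[n]}^{(2m)}=\frac1n\sum_{i=1}^n d_i^{2m}$. *)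

theory Defs
  imports "HOL-Analysis.Analysis"
begin

definition vertices :: "(real^3) set \<Rightarrow> (real^3) set" where
  "vertices P = {v. v extreme_point_of P}"

definition is_flag :: "(real^3) set \<Rightarrow> real^3 \<Rightarrow> (real^3) set \<Rightarrow> (real^3) set \<Rightarrow> bool" where
  "is_flag P v e F \<longleftrightarrow> v \<in> vertices P \<and> e edge_of P \<and> F facet_of P \<and> v \<in> e \<and> e \<subseteq> F"

definition is_symmetry :: "(real^3) set \<Rightarrow> (real^3 \<Rightarrow> real^3) \<Rightarrow> bool" where
  "is_symmetry P f \<longleftrightarrow> (\<forall>x y. dist (f x) (f y) = dist x y) \<and> f ` P = P"

text \<open>A Platonic solid is a convex regular polyhedron in 3-space: a full-dimensional convex
  polytope whose symmetry group (reflections included) is transitive on flags. Up to similarity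
  these are the regular tetrahedron, octahedron, cube, icosahedron and dodecahedron, which the
  vertex counts 4, 6, 8, 12 and 20 tell apart.\<close>

definition platonic_solid :: "(real^3) set \<Rightarrow> bool" where
  "platonic_solid P \<longleftrightarrow> polytope P \<and> aff_dim P = 3 \<and>
     (\<forall>v e F v' e' F'. is_flag P v e F \<and> is_flag P v' e' F' \<longrightarrow>
        (\<exists>f. is_symmetry P f \<and> f v = v' \<and> f ` e = e' \<and> f ` F = F'))"

text \<open>The centre of the circumscribed sphere is not presupposed to be the centroid.\<close>

definition is_circumradius :: "(real^3) set \<Rightarrow> real \<Rightarrow> bool" where
  "is_circumradius P R \<longleftrightarrow> (\<exists>C. vertices P \<subseteq> sphere C R)"

definition centroid :: "(real^3) set \<Rightarrow> real^3" where
  "centroid P = (1 / real (card (vertices P))) *\<^sub>R (\<Sum>v\<in>vertices P. v)"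

text \<open>\<open>S_avg n A M k\<close> is the average of the \<open>k\<close>-th powers of the distances from \<open>M\<close> to
  \<open>A 1, \<dots>, A n\<close>, so \<open>k\<close> is the full exponent \<open>2m\<close> of \<open>S\<^sub>[\<^sub>n\<^sub>]\<^sup>(\<^sup>2\<^sup>m\<^sup>)\<close>.\<close>

definition S_avg :: "nat \<Rightarrow> (nat \<Rightarrow> real^3) \<Rightarrow> real^3 \<Rightarrow> nat \<Rightarrow> real" where
  "S_avg n A M k = (1 / real n) * (\<Sum>i=1..n. dist M (A i) ^ k)"

end

theory Submission
  imports Defs
begin

text \<open>
  Let \<open>O\<close> be the centroid and \<open>u\<close> range over the vectors from \<open>O\<close> to the vertices. The symmetries
  fix \<open>O\<close>, so they commute with the self-adjoint operator \<open>T x = \<Sum>u. (u \<bullet> x) u\<close>. If \<open>T\<close> is not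
  scalar, one of its extreme eigenspaces is a line, which all symmetries preserve. By vertex
  transitivity the vertices then lie on two planes orthogonal to that line. One of the two faces
  they cut out contains an edge, and some edge leaves that face; this contradicts edge
  transitivity. Hence \<open>T\<close> is scalar, and comparing traces gives \<open>\<Sum>u. (u \<bullet> x)\<^sup>2 = n R\<^sup>2 |x|\<^sup>2 / 3\<close>.
  It follows that \<open>S\<^sup>(\<^sup>2\<^sup>) = R\<^sup>2 + L\<^sup>2\<close> and \<open>S\<^sup>(\<^sup>4\<^sup>) = (R\<^sup>2 + L\<^sup>2)\<^sup>2 + 4/3 R\<^sup>2 L\<^sup>2\<close>, so the discriminant
  is \<open>(R\<^sup>2 - L\<^sup>2)\<^sup>2\<close>.
\<close>

section \<open>Extreme eigenvectors of self-adjoint operators\<close>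

text \<open>If \<open>S x\<close> were nonzero, a small step from \<open>x\<close> against
  \<open>S x\<close> would make the form negative: along that line it has no constant term and slope
  \<open>2 * (S x \<bullet> S x)\<close> at \<open>x\<close>.\<close>

lemma psd_null_vector:
  fixes S :: "'a::real_inner \<Rightarrow> 'a"
  assumes "linear S" and sa: "\<And>x y. S x \<bullet> y = x \<bullet> S y"
    and psd: "\<And>x. 0 \<le> x \<bullet> S x" and null: "x \<bullet> S x = 0"
  shows "S x = 0"
proof (rule ccontr)
  assume "S x \<noteq> 0"
  define b where "b = S x \<bullet> S x"
  define d where "d = S x \<bullet> S (S x)"
  have "b > 0" "d \<ge> 0"
    using \<open>S x \<noteq> 0\<close> psd by (auto simp: b_def d_def)
  have expand: "(x + t *\<^sub>R S x) \<bullet> S (x + t *\<^sub>R S x) = 2 * t * b + t\<^sup>2 * d" for t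
    using null sa[of x "S x"]
    by (simp add: linear_add[OF \<open>linear S\<close>] linear_cmul[OF \<open>linear S\<close>] inner_add_left
        inner_add_right b_def d_def power2_eq_square algebra_simps)
  \<comment> \<open>For \<open>d > 0\<close> the quadratic in \<open>t\<close> is least at
    \<open>- b / d\<close>; the denominator \<open>d + 1\<close> also covers \<open>d = 0\<close>
    and still gives a negative value.\<close>
  define t where "t = - b / (d + 1)"
  have "0 \<le> 2 * t * b + t\<^sup>2 * d"
    using psd[of "x + t *\<^sub>R S x"] expand by simp
  moreover have "2 * t * b + t\<^sup>2 * d = b\<^sup>2 * (- d - 2) / (d + 1)\<^sup>2"
    using \<open>d \<ge> 0\<close> unfolding t_def by (simp add: divide_simps power2_eq_square) (simp add: algebra_simps)
  moreover have "b\<^sup>2 * (- d - 2) / (d + 1)\<^sup>2 < 0"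
    using \<open>b > 0\<close> \<open>d \<ge> 0\<close> by (intro divide_neg_pos mult_pos_neg) auto
  ultimately show False by linarith
qed

text \<open>The form attains its maximum \<open>c\<close> over the compact unit sphere at some
  \<open>p\<close>. Then \<open>c *\<^sub>R x - T x\<close> has a nonnegative form vanishing at
  \<open>p\<close>, and \<open>psd_null_vector\<close> turns this into the eigenvector
  equation.\<close>

lemma max_quadratic_form_eigenvector:
  fixes T :: "'a::euclidean_space \<Rightarrow> 'a"
  assumes lin: "linear T" and sa: "\<And>x y. T x \<bullet> y = x \<bullet> T y"
  obtains p c where "norm p = 1" "T p = c *\<^sub>R p" "\<And>x. x \<bullet> T x \<le> c * (x \<bullet> x)"
proof -
  have "continuous_on (sphere 0 1) (\<lambda>x. x \<bullet> T x)"
    using lin by (intro continuous_intros linear_continuous_on linear_conv_bounded_linear[THEN iffD1])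
  moreover have "sphere (0::'a) 1 \<noteq> {}" by simp
  ultimately obtain p where p: "p \<in> sphere 0 1" "\<And>x. x \<in> sphere 0 1 \<Longrightarrow> x \<bullet> T x \<le> p \<bullet> T p"
    using continuous_attains_sup[OF compact_sphere, of 0 1 "\<lambda>x. x \<bullet> T x"] by blast
  define c where "c = p \<bullet> T p"
  have le: "x \<bullet> T x \<le> c * (x \<bullet> x)" for x
  proof (cases "x = 0")
    case False
    define y where "y = x /\<^sub>R norm x"
    have x: "x = norm x *\<^sub>R y" and "norm y = 1"
      using False by (auto simp: y_def)
    then have "y \<bullet> T y \<le> c" using p(2)[of y] by (simp add: c_def)
    then have "(norm x)\<^sup>2 * (y \<bullet> T y) \<le> (norm x)\<^sup>2 * c" by (intro mult_left_mono) auto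
    moreover have "x \<bullet> T x = (norm x)\<^sup>2 * (y \<bullet> T y)"
      by (subst (1 2) x) (simp add: linear_cmul[OF lin] power2_eq_square)
    ultimately show ?thesis by (simp add: dot_square_norm mult.commute)
  qed (simp add: linear_0[OF lin])
  define S where "S x = c *\<^sub>R x - T x" for x
  have "linear S"
    unfolding S_def using lin by (intro linear_compose_sub linear_compose_scale_right linear_ident)
  have "S p = 0"
  proof (rule psd_null_vector[OF \<open>linear S\<close>])
    show "S x \<bullet> y = x \<bullet> S y" for x y
      using sa by (simp add: S_def inner_diff_left inner_diff_right)
    show "0 \<le> x \<bullet> S x" for x
      using le[of x] by (simp add: S_def inner_diff_right)
    show "p \<bullet> S p = 0"
      using p(1) by (simp add: S_def inner_diff_right c_def dot_square_norm)
  qed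
  then show thesis
    using p(1) le that[of p c] by (auto simp: S_def)
qed

text \<open>In dimension 3 the eigenspaces of the largest and the smallest eigenvalue cannot both be
  planes, being orthogonal.\<close>

lemma self_adjoint_scalar_or_eigenline:
  fixes T :: "real^3 \<Rightarrow> real^3"
  assumes lin: "linear T" and sa: "\<And>x y. T x \<bullet> y = x \<bullet> T y"
  obtains c where "\<And>x. T x = c *\<^sub>R x"
  | a c where "norm a = 1" "T a = c *\<^sub>R a" "\<And>x. T x = c *\<^sub>R x \<Longrightarrow> x \<in> span {a}"
proof -
  obtain p M where p: "norm p = 1" "T p = M *\<^sub>R p" and M: "\<And>x. x \<bullet> T x \<le> M * (x \<bullet> x)"
    using max_quadratic_form_eigenvector[OF lin sa] by blast
  \<comment> \<open>The largest eigenvalue of \<open>- T\<close>, negated, is the smallest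
    eigenvalue \<open>m\<close> of \<open>T\<close>.\<close>
  have "linear (\<lambda>x. - T x)" by (rule linear_compose_neg[OF lin])
  then obtain q m' where q: "norm q = 1" "- T q = m' *\<^sub>R q"
    and m': "\<And>x. x \<bullet> - T x \<le> m' * (x \<bullet> x)"
    using max_quadratic_form_eigenvector[of "\<lambda>x. - T x"] sa by (metis inner_minus_left inner_minus_right)
  define m where "m = - m'"
  have q: "norm q = 1" "T q = m *\<^sub>R q" and m: "\<And>x. m * (x \<bullet> x) \<le> x \<bullet> T x"
    using q m' by (auto simp: m_def minus_equation_iff[of "T q"] minus_le_iff)
  define E where "E c = {x. T x = c *\<^sub>R x}" for c
  have line: "x \<in> span {a}"
    if "norm a = 1" "T a = c *\<^sub>R a" "dim (E c) \<le> 1" "T x = c *\<^sub>R x" for a c x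
  proof -
    have "a \<noteq> 0" using \<open>norm a = 1\<close> by auto
    then have "E c \<subseteq> span {a}"
      using that by (intro card_ge_dim_independent) (auto simp: E_def)
    then show ?thesis using that(4) by (auto simp: E_def)
  qed
  show thesis
  proof (cases "M = m")
    case True
    define S where "S x = M *\<^sub>R x - T x" for x
    have "linear S"
      unfolding S_def using lin by (intro linear_compose_sub linear_compose_scale_right linear_ident)
    \<comment> \<open>The upper and lower bounds on the form coincide, so every vector is a null
      vector of the semidefinite \<open>S\<close>.\<close>
    have "S x = 0" for x
    proof (rule psd_null_vector[OF \<open>linear S\<close>])
      show "S x \<bullet> y = x \<bullet> S y" for x y
        using sa by (simp add: S_def inner_diff_left inner_diff_right)
      show "0 \<le> x \<bullet> S x" for x
        using M[of x] by (simp add: S_def inner_diff_right)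
      show "x \<bullet> S x = 0"
        using M[of x] m[of x] True by (simp add: S_def inner_diff_right)
    qed
    then show thesis by (intro that(1)[of M]) (simp add: S_def)
  next
    case False
    have "subspace (E M)" unfolding E_def
      by (auto simp: subspace_def linear_0[OF lin] linear_add[OF lin] linear_cmul[OF lin] algebra_simps)
    then have "dim {y \<in> UNIV. \<forall>x \<in> E M. orthogonal x y} + dim (E M) = 3"
      using dim_subspace_orthogonal_to_vectors[of "E M" UNIV] by simp
    moreover have "E m \<subseteq> {y \<in> UNIV. \<forall>x \<in> E M. orthogonal x y}"
    proof clarsimp
      fix x y assume "y \<in> E m" "x \<in> E M"
      then have "M * (x \<bullet> y) = m * (x \<bullet> y)" using sa[of x y] by (simp add: E_def)
      then show "orthogonal x y" using False by (simp add: orthogonal_def)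
    qed
    then have "dim (E m) \<le> dim {y \<in> UNIV. \<forall>x \<in> E M. orthogonal x y}" by (rule dim_subset)
    ultimately have "dim (E M) \<le> 1 \<or> dim (E m) \<le> 1" by linarith
    then show thesis using line p q that(2) by blast
  qed
qed

section \<open>Faces and edges of polytopes\<close>

lemma polytope_extreme_point_exists:
  fixes F :: "'a::euclidean_space set"
  assumes "polytope F" "F \<noteq> {}"
  obtains v where "v extreme_point_of F"
proof -
  have "F = convex hull {x. x extreme_point_of F}"
    using assms(1) by (intro Krein_Milman_Minkowski polytope_imp_compact polytope_imp_convex)
  then have "{x. x extreme_point_of F} \<noteq> {}"
    using assms(2) by (metis convex_hull_empty)
  then show thesis using that by blast
qed

text \<open>Induction on the dimension of \<open>F\<close>: take a vertex \<open>v\<close> of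
  \<open>T\<close> and a facet \<open>G\<close> of \<open>F\<close> through \<open>v\<close> not
  inside \<open>T\<close>, then recurse to the proper face \<open>T \<inter> G\<close> of
  \<open>G\<close>. In dimension 1, \<open>F\<close> is itself the edge.\<close>

lemma edge_leaving_face:
  fixes F :: "'a::euclidean_space set"
  assumes "polytope F" "T face_of F" "T \<noteq> {}" "T \<noteq> F"
  shows "\<exists>e. e edge_of F \<and> e \<inter> T \<noteq> {} \<and> \<not> e \<subseteq> T"
  using assms
proof (induction "nat (aff_dim F)" arbitrary: F T rule: less_induct)
  case less
  have "convex F" using less.prems(1) by (rule polytope_imp_convex)
  have lt: "aff_dim T < aff_dim F"
    using face_of_aff_dim_lt[OF \<open>convex F\<close>] less.prems by blast
  have "aff_dim T \<ge> 0" using \<open>T \<noteq> {}\<close> by (metis aff_dim_empty aff_dim_geq aff_dim_negative_iff not_less)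
  have "T \<subseteq> F" using less.prems(2) by (rule face_of_imp_subset)
  show ?case
  proof (cases "aff_dim F = 1")
    case True
    then have "F edge_of F" using \<open>convex F\<close> by (simp add: edge_of_def face_of_refl)
    then show ?thesis using \<open>T \<subseteq> F\<close> less.prems by blast
  next
    case False
    have "polytope T" using less.prems face_of_polytope_polytope by blast
    then obtain v where "v extreme_point_of T"
      using \<open>T \<noteq> {}\<close> polytope_extreme_point_exists by blast
    then have v: "v extreme_point_of F" "v \<in> T"
      using extreme_point_of_face less.prems(2) by blast+
    have "{v} \<noteq> F" using lt \<open>aff_dim T \<ge> 0\<close> by auto
    then have vI: "{v} = \<Inter>{G. G facet_of F \<and> {v} \<subseteq> G}"
      using face_of_polyhedron[OF polytope_imp_polyhedron[OF less.prems(1)], of "{v}"] v(1)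
      unfolding face_of_singleton by blast
    \<comment> \<open>Otherwise every facet through \<open>v\<close> equals \<open>T\<close>, since
      a proper face of \<open>T\<close> has too small a dimension for a facet. As \<open>{v}\<close>
      is the intersection of these facets, \<open>T = {v}\<close> is a facet, which forces dimension
      1.\<close>
    have "\<exists>G. G facet_of F \<and> v \<in> G \<and> \<not> G \<subseteq> T"
    proof (rule ccontr)
      assume neg: "\<not> ?thesis"
      have eq: "G = T" if "G facet_of F" "v \<in> G" for G
      proof (rule ccontr)
        assume "G \<noteq> T"
        have "G \<subseteq> T" using that neg by blast
        then have "G face_of T"
          using face_of_subset facet_of_imp_face_of \<open>T \<subseteq> F\<close> that(1) by blast
        then have "aff_dim G < aff_dim T"
          using \<open>G \<noteq> T\<close> \<open>polytope T\<close> by (intro face_of_aff_dim_lt polytope_imp_convex)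
        then show False using that(1) lt by (simp add: facet_of_def)
      qed
      have "{v} face_of F" using v(1) by (simp add: face_of_singleton)
      then obtain G where G: "G facet_of F" "{v} \<subseteq> G"
        using face_of_polyhedron_subset_facet[OF polytope_imp_polyhedron[OF less.prems(1)], of "{v}"]
          \<open>{v} \<noteq> F\<close> by blast
      have "T \<subseteq> \<Inter>{G. G facet_of F \<and> {v} \<subseteq> G}" using eq by blast
      then have "T = {v}" using v(2) unfolding vI[symmetric] by blast
      then have "G = {v}" using eq G by blast
      then have "aff_dim G = 0" by simp
      then show False using G(1) False by (simp add: facet_of_def)
    qed
    then obtain G where G: "G facet_of F" "v \<in> G" "\<not> G \<subseteq> T" by blast
    have "G face_of F" using G(1) by (rule facet_of_imp_face_of)
    have "nat (aff_dim G) < nat (aff_dim F)"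
      using G(1) lt \<open>aff_dim T \<ge> 0\<close> by (simp add: facet_of_def)
    moreover have "polytope G" using \<open>G face_of F\<close> less.prems(1) face_of_polytope_polytope by blast
    moreover have "T \<inter> G face_of G"
      using face_of_subset[OF face_of_Int[OF less.prems(2) \<open>G face_of F\<close>]]
        face_of_imp_subset[OF \<open>G face_of F\<close>] by simp
    ultimately obtain e where "e edge_of G" "e \<inter> (T \<inter> G) \<noteq> {}" "\<not> e \<subseteq> T \<inter> G"
      using less.hyps[of G "T \<inter> G"] v(2) G(2,3) by blast
    moreover from this have "e \<subseteq> G" by (simp add: edge_of_imp_subset)
    moreover have "e edge_of F"
      using \<open>e edge_of G\<close> face_of_trans[OF _ \<open>G face_of F\<close>] by (simp add: edge_of_def)
    ultimately show ?thesis by blast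
  qed
qed

section \<open>Vertices and the action of symmetries\<close>

lemma polytope_eq_hull_vertices:
  "polytope P \<Longrightarrow> P = convex hull (vertices P)"
  unfolding vertices_def
  by (simp add: Krein_Milman_Minkowski polytope_imp_compact polytope_imp_convex)

lemma finite_vertices: "polytope P \<Longrightarrow> finite (vertices P)"
  unfolding vertices_def by (simp add: finite_polyhedron_extreme_points polytope_imp_polyhedron)

lemma vertices_not_in_hyperplane:
  assumes "polytope P" "aff_dim P = 3" "a \<noteq> 0"
  shows "\<not> vertices P \<subseteq> {x. a \<bullet> x = b}"
proof
  assume "vertices P \<subseteq> {x. a \<bullet> x = b}"
  then have "P \<subseteq> {x. a \<bullet> x = b}"
    using polytope_eq_hull_vertices[OF assms(1)] hull_minimal convex_hyperplane by metis
  then show False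
    using aff_dim_subset[of P "{x. a \<bullet> x = b}"] assms by simp
qed

text \<open>An isometry is an orthogonal map followed by a translation. It permutes the extreme
  points, so it fixes their average and becomes linear once the origin is moved there.\<close>

lemma symmetry_linear_part:
  assumes "is_symmetry P f" "polytope P" "P \<noteq> {}"
  obtains g where "orthogonal_transformation g"
    "\<And>x. f x - centroid P = g (x - centroid P)" "bij_betw f (vertices P) (vertices P)"
proof -
  define g where "g x = f x - f 0" for x
  have g: "orthogonal_transformation g"
    using assms(1) unfolding orthogonal_transformation_isometry g_def is_symmetry_def
    by (simp add: dist_norm)
  have "inj g" "linear g"
    using g by (auto intro: orthogonal_transformation_inj orthogonal_transformation_linear)
  have "f x extreme_point_of f ` P \<longleftrightarrow> x extreme_point_of P" for x
  proof -
    have "f x extreme_point_of f ` P \<longleftrightarrow> f 0 + g x extreme_point_of (\<lambda>x. f 0 + x) ` (g ` P)"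
      by (simp add: g_def image_comp o_def)
    also have "\<dots> \<longleftrightarrow> {g x} face_of g ` P"
      by (simp only: extreme_point_of_translation_eq face_of_singleton)
    also have "\<dots> \<longleftrightarrow> x extreme_point_of P"
      using face_of_linear_image[OF \<open>linear g\<close> \<open>inj g\<close>, of "{x}" P] by (simp add: face_of_singleton)
    finally show ?thesis .
  qed
  moreover have "f ` P = P" using assms(1) by (simp add: is_symmetry_def)
  ultimately have *: "f x \<in> vertices P \<longleftrightarrow> x \<in> vertices P" for x
    by (simp add: vertices_def)
  have "surj f" using g orthogonal_transformation_surj[OF g] unfolding surj_def g_def
    by (metis add.commute diff_add_cancel add_diff_cancel_right')
  then have "f ` vertices P = vertices P" using * by (force simp: surj_def)
  moreover have "inj f" using \<open>inj g\<close> by (simp add: inj_def g_def)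
  ultimately have bij: "bij_betw f (vertices P) (vertices P)"
    by (auto simp: bij_betw_def intro: inj_on_subset)
  have "vertices P \<noteq> {}"
    using polytope_extreme_point_exists[OF assms(2,3)] by (auto simp: vertices_def)
  then have n: "real (card (vertices P)) \<noteq> 0" using finite_vertices[OF assms(2)] by simp
  have "(\<Sum>v\<in>vertices P. v) = (\<Sum>v\<in>vertices P. f v)"
    using sum.reindex_bij_betw[OF bij, of "\<lambda>x. x"] by simp
  also have "\<dots> = (\<Sum>v\<in>vertices P. f 0 + g v)" by (simp add: g_def)
  also have "\<dots> = real (card (vertices P)) *\<^sub>R f 0 + g (\<Sum>v\<in>vertices P. v)"
    by (simp only: sum.distrib sum_constant_scaleR linear_sum[OF \<open>linear g\<close>])
  finally have S: "(\<Sum>v\<in>vertices P. v) = \<dots>" .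
  \<comment> \<open>Dividing the reindexed vertex sum by the number of vertices shows that
    \<open>f\<close> fixes the centroid.\<close>
  have "centroid P = f 0 + g (centroid P)"
    unfolding centroid_def linear_cmul[OF \<open>linear g\<close>]
    by (subst S) (use n in \<open>simp add: scaleR_add_right\<close>)
  then have "f x - centroid P = g (x - centroid P)" for x
    by (simp add: linear_diff[OF \<open>linear g\<close>]) (simp add: g_def algebra_simps)
  then show thesis using that g bij by blast
qed

section \<open>From flag transitivity to edge and vertex transitivity\<close>

lemma flag_through_edge:
  assumes "polytope P" "aff_dim P = 3" "e edge_of P" "v \<in> vertices P" "v \<in> e"
  shows "\<exists>F. is_flag P v e F"
proof -
  have "e \<noteq> P" "e face_of P" using assms by (auto simp: edge_of_def)
  then obtain F where "F facet_of P" "e \<subseteq> F"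
    using face_of_polyhedron_subset_facet[of P e] assms polytope_imp_polyhedron by blast
  then show ?thesis using assms by (auto simp: is_flag_def)
qed

lemma edge_has_vertex:
  assumes "polytope P" "e edge_of P"
  obtains v where "v \<in> vertices P" "v \<in> e"
proof -
  have e: "e face_of P" "e \<noteq> {}" using assms by (auto simp: edge_of_def)
  then obtain v where "v extreme_point_of e"
    using polytope_extreme_point_exists face_of_polytope_polytope assms(1) by blast
  then show thesis using that extreme_point_of_face[OF e(1)] by (auto simp: vertices_def)
qed

lemma platonic_edge_transitive:
  assumes "platonic_solid P" "e edge_of P" "e' edge_of P"
  obtains f where "is_symmetry P f" "f ` e = e'"
proof -
  have P: "polytope P" "aff_dim P = 3" using assms by (auto simp: platonic_solid_def)
  obtain v v' where "v \<in> vertices P" "v \<in> e" "v' \<in> vertices P" "v' \<in> e'"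
    using edge_has_vertex P(1) assms(2,3) by metis
  then obtain F F' where "is_flag P v e F" "is_flag P v' e' F'"
    using flag_through_edge P assms(2,3) by metis
  then show thesis using assms(1) that unfolding platonic_solid_def by blast
qed

lemma platonic_vertex_transitive:
  assumes "platonic_solid P" "v \<in> vertices P" "v' \<in> vertices P"
  obtains f where "is_symmetry P f" "f v = v'"
proof -
  have P: "polytope P" "aff_dim P = 3" using assms by (auto simp: platonic_solid_def)
  have "\<exists>e F. is_flag P w e F" if "w \<in> vertices P" for w
  proof -
    have "{w} face_of P" "{w} \<noteq> P"
      using that P by (auto simp: vertices_def face_of_singleton)
    \<comment> \<open>An edge leaving the face \<open>{w}\<close> meets it, hence contains
      \<open>w\<close>; this starts a flag at \<open>w\<close>.\<close>
    then obtain e where "e edge_of P" "w \<in> e"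
      using edge_leaving_face[OF P(1), of "{w}"] by auto
    then show ?thesis using flag_through_edge P that by blast
  qed
  then obtain e F e' F' where "is_flag P v e F" "is_flag P v' e' F'"
    using assms(2,3) by metis
  then show thesis using assms(1) that unfolding platonic_solid_def by blast
qed

section \<open>No invariant axis, hence isotropic second moments\<close>

text \<open>The hypotheses say that symmetries preserve heights along \<open>a\<close> over the
  centroid, and height differences, up to sign. The contradiction is between an edge of constant
  height and one of varying height.\<close>

lemma platonic_no_invariant_line:
  assumes P: "platonic_solid P" and "a \<noteq> 0"
    and inv: "\<And>f x. is_symmetry P f \<Longrightarrow>
      (a \<bullet> (f x - centroid P))\<^sup>2 = (a \<bullet> (x - centroid P))\<^sup>2"
    and invd: "\<And>f x y. is_symmetry P f \<Longrightarrow> (a \<bullet> (f x - f y))\<^sup>2 = (a \<bullet> (x - y))\<^sup>2"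
  shows False
proof -
  have pP: "polytope P" "aff_dim P = 3" using P by (auto simp: platonic_solid_def)
  then have "P \<noteq> {}" "convex P" by (auto simp: polytope_imp_convex)
  define c where "c = centroid P"
  obtain v0 where v0: "v0 \<in> vertices P"
    using polytope_extreme_point_exists[OF pP(1) \<open>P \<noteq> {}\<close>] by (auto simp: vertices_def)
  define h where "h = \<bar>a \<bullet> (v0 - c)\<bar>"
  have sq: "\<bar>a \<bullet> (v - c)\<bar> = h" if v: "v \<in> vertices P" for v
  proof -
    obtain f where "is_symmetry P f" "f v0 = v"
      using platonic_vertex_transitive[OF P v0 v] .
    then have "(a \<bullet> (v - c))\<^sup>2 = (a \<bullet> (v0 - c))\<^sup>2" using inv[of f v0] by (simp add: c_def)
    then show ?thesis unfolding h_def by (metis real_sqrt_abs)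
  qed
  \<comment> \<open>All vertices have height \<open>h\<close> or \<open>- h\<close> over the
    centroid, so these two slices are faces of \<open>P\<close> containing every vertex.\<close>
  define tp where "tp = P \<inter> {x. a \<bullet> x = a \<bullet> c + h}"
  define bt where "bt = P \<inter> {x. a \<bullet> x = a \<bullet> c - h}"
  have VP: "vertices P \<subseteq> P" by (auto simp: vertices_def extreme_point_of_def)
  have hull: "P \<subseteq> S" if "convex S" "vertices P \<subseteq> S" for S
    using polytope_eq_hull_vertices[OF pP(1)] hull_minimal[of "vertices P" S convex] that by simp
  have "vertices P \<subseteq> {x. a \<bullet> x \<le> a \<bullet> c + h}" "vertices P \<subseteq> {x. a \<bullet> x \<ge> a \<bullet> c - h}"
    using sq by (force simp: inner_diff_right abs_le_iff)+
  then have "P \<subseteq> {x. a \<bullet> x \<le> a \<bullet> c + h}" "P \<subseteq> {x. a \<bullet> x \<ge> a \<bullet> c - h}"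
    using hull[OF convex_halfspace_le] hull[OF convex_halfspace_ge] by blast+
  then have faces: "tp face_of P" "bt face_of P"
    unfolding tp_def bt_def
    using face_of_Int_supporting_hyperplane_le[OF \<open>convex P\<close>, of a]
      face_of_Int_supporting_hyperplane_ge[OF \<open>convex P\<close>, of _ a] by blast+
  have cover: "vertices P \<subseteq> tp \<union> bt"
  proof
    fix v assume v: "v \<in> vertices P"
    then have "a \<bullet> v = a \<bullet> c + h \<or> a \<bullet> v = a \<bullet> c - h"
      using sq[OF v] by (auto simp: inner_diff_right abs_if split: if_splits)
    then show "v \<in> tp \<union> bt" using v VP by (auto simp: tp_def bt_def)
  qed
  \<comment> \<open>If each slice had at most one point, \<open>P\<close> would be the hull of two
    points, of dimension at most 1.\<close>
  have "\<exists>b F. F = P \<inter> {x. a \<bullet> x = b} \<and> F face_of P \<and> aff_dim F \<ge> 1"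
  proof (rule ccontr)
    assume "\<not> ?thesis"
    then have "aff_dim tp < 1" "aff_dim bt < 1" using faces unfolding tp_def bt_def by force+
    then have "aff_dim tp = -1 \<or> aff_dim tp = 0" "aff_dim bt = -1 \<or> aff_dim bt = 0"
      using aff_dim_geq[of tp] aff_dim_geq[of bt] by linarith+
    then obtain s t where "tp \<subseteq> {s}" "bt \<subseteq> {t}"
      by (metis aff_dim_empty aff_dim_eq_0 empty_subsetI order_refl)
    then have "vertices P \<subseteq> {s, t}" using cover by auto
    then have "P \<subseteq> convex hull {s, t}" by (meson hull hull_subset convex_convex_hull subset_trans)
    then have "aff_dim P \<le> aff_dim {s, t}" using aff_dim_subset aff_dim_convex_hull by metis
    then show False using pP(2) by (simp split: if_splits)
  qed
  then obtain b F where F: "F = P \<inter> {x. a \<bullet> x = b}" "F face_of P" "aff_dim F \<ge> 1" by blast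
  have "F \<noteq> {}" using F(3) by auto
  have "F \<noteq> P" using vertices_not_in_hyperplane[OF pP \<open>a \<noteq> 0\<close>, of b] F(1) VP by auto
  have "polytope F" using F(2) pP(1) face_of_polytope_polytope by blast
  then obtain w where "w extreme_point_of F" using \<open>F \<noteq> {}\<close> polytope_extreme_point_exists by blast
  moreover have "{w} \<noteq> F" using F(3) by auto
  ultimately obtain e where e: "e edge_of F"
    using edge_leaving_face[OF \<open>polytope F\<close>, of "{w}"] by (auto simp: face_of_singleton)
  then have eP: "e edge_of P" "e \<subseteq> F"
    using F(2) face_of_trans by (auto simp: edge_of_def dest: face_of_imp_subset)
  obtain e' where e': "e' edge_of P" "e' \<inter> F \<noteq> {}" "\<not> e' \<subseteq> F"
    using edge_leaving_face[OF pP(1) F(2) \<open>F \<noteq> {}\<close> \<open>F \<noteq> P\<close>] by blast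
  obtain f where f: "is_symmetry P f" "f ` e = e'"
    using platonic_edge_transitive[OF P eP(1) e'(1)] .
  \<comment> \<open>The image edge meets the plane of \<open>F\<close> and also leaves it, so
    \<open>f x\<close> and \<open>f y\<close> differ in height, whereas \<open>x\<close> and
    \<open>y\<close> both lie in \<open>F\<close>.\<close>
  obtain x y where xy: "x \<in> e" "y \<in> e" "f x \<in> F" "f y \<notin> F" using e' f(2) by blast
  moreover have "f y \<in> P" using xy f(2) e'(1) edge_of_imp_subset by blast
  ultimately have "a \<bullet> (f x - f y) \<noteq> 0" using F(1) by (auto simp: inner_diff_right)
  moreover have "x \<in> F" "y \<in> F" using xy(1,2) eP(2) by blast+
  then have "a \<bullet> (x - y) = 0" using F(1) by (simp add: inner_diff_right)
  ultimately show False using invd[OF f(1), of x y] by simp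
qed

text \<open>The left side is the second-moment operator of the vertices about the centroid. It
  commutes with the linear parts of symmetries, so a one-dimensional eigenspace would be an
  invariant axis.\<close>

lemma platonic_frame:
  assumes P: "platonic_solid P"
  obtains c where
    "\<And>x. (\<Sum>v\<in>vertices P. ((v - centroid P) \<bullet> x) *\<^sub>R (v - centroid P)) = c *\<^sub>R x"
proof -
  define z where "z = centroid P"
  have pP: "polytope P" "P \<noteq> {}" using P by (auto simp: platonic_solid_def)
  define T where "T x = (\<Sum>v\<in>vertices P. ((v - z) \<bullet> x) *\<^sub>R (v - z))" for x
  have "linear T"
    unfolding T_def
    by (rule linearI) (simp_all add: inner_add_right scaleR_add_left sum.distrib scaleR_sum_right)
  have sa: "T x \<bullet> y = x \<bullet> T y" for x y
    unfolding T_def by (simp add: inner_sum_left inner_sum_right inner_commute mult.commute)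
  show thesis
  proof (rule self_adjoint_scalar_or_eigenline[OF \<open>linear T\<close> sa])
    fix c assume "\<And>x. T x = c *\<^sub>R x"
    then show thesis unfolding T_def z_def by (rule that)
  next
    fix a c assume a: "norm a = 1" "T a = c *\<^sub>R a" "\<And>x. T x = c *\<^sub>R x \<Longrightarrow> x \<in> span {a}"
    \<comment> \<open>Reindexing the vertex sum by \<open>f\<close> gives
      \<open>T (g a) = g (T a)\<close>, so \<open>g a\<close> stays on the eigenline. Orthogonality
      makes its factor \<open>k\<close> equal to 1 or -1, which squaring removes.\<close>
    have inv: "(a \<bullet> g x)\<^sup>2 = (a \<bullet> x)\<^sup>2"
      if "is_symmetry P f" and g: "orthogonal_transformation g"
        and fg: "\<And>x. f x - z = g (x - z)" and bij: "bij_betw f (vertices P) (vertices P)" for f g x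
    proof -
      have "linear g" and gi: "\<And>x y. g x \<bullet> g y = x \<bullet> y"
        using g by (auto simp: orthogonal_transformation_def)
      have "T (g a) = (\<Sum>v\<in>vertices P. ((f v - z) \<bullet> g a) *\<^sub>R (f v - z))"
        unfolding T_def by (rule sum.reindex_bij_betw[OF bij, symmetric])
      also have "\<dots> = g (T a)"
        by (simp add: fg gi T_def linear_sum[OF \<open>linear g\<close>] linear_cmul[OF \<open>linear g\<close>])
      finally have "T (g a) = c *\<^sub>R g a" by (simp add: a(2) linear_cmul[OF \<open>linear g\<close>])
      then have "g a \<in> span {a}" by (rule a(3))
      then obtain k where k: "g a = k *\<^sub>R a" by (auto simp: span_singleton)
      then have "k\<^sup>2 = 1"
        using gi[of a a] a(1) by (simp add: dot_square_norm power2_eq_square)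
      moreover have "k * (a \<bullet> g x) = a \<bullet> x" using gi[of a x] by (simp add: k)
      ultimately show ?thesis by (metis power_mult_distrib mult_1)
    qed
    have "(a \<bullet> (f x - z))\<^sup>2 = (a \<bullet> (x - z))\<^sup>2 \<and> (a \<bullet> (f x - f y))\<^sup>2 = (a \<bullet> (x - y))\<^sup>2"
      if f: "is_symmetry P f" for f x y
    proof -
      obtain g where g: "orthogonal_transformation g" "\<And>x. f x - z = g (x - z)"
        "bij_betw f (vertices P) (vertices P)"
        using symmetry_linear_part[OF f pP] unfolding z_def by blast
      have "f x - f y = g (x - y)"
        using linear_diff[OF orthogonal_transformation_linear[OF g(1)], of "x - z" "y - z"]
        by (simp flip: g(2))
      then show ?thesis using inv[OF f g] by (simp add: g(2))
    qed
    moreover have "a \<noteq> 0" using a(1) by auto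
    ultimately have False using platonic_no_invariant_line[OF P] unfolding z_def by blast
    then show thesis ..
  qed
qed

section \<open>The circumcentre and the trace of the second moments\<close>

text \<open>Vertex transitivity makes the centroid equidistant from all vertices. A second
  equidistant point \<open>C\<close> would confine them to a plane.\<close>

lemma platonic_circumcenter:
  assumes P: "platonic_solid P" and R: "is_circumradius P R" and "v \<in> vertices P"
  shows "norm (v - centroid P) = R"
proof -
  have pP: "polytope P" "aff_dim P = 3" "P \<noteq> {}" using P by (auto simp: platonic_solid_def)
  define z where "z = centroid P"
  obtain C where C: "vertices P \<subseteq> sphere C R" using R by (auto simp: is_circumradius_def)
  have eq: "norm (w - z) = norm (v - z)" if w: "w \<in> vertices P" for w
  proof -
    obtain f where f: "is_symmetry P f" "f v = w"
      using platonic_vertex_transitive[OF P \<open>v \<in> vertices P\<close> w] .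
    obtain g where g: "orthogonal_transformation g" "\<And>x. f x - z = g (x - z)"
      using symmetry_linear_part[OF f(1) pP(1,3)] unfolding z_def by blast
    then show ?thesis using g(2)[of v] f(2) orthogonal_transformation_norm by metis
  qed
  \<comment> \<open>This plane comes from subtracting the equations of the spheres about
    \<open>C\<close> and \<open>z\<close>, which cancels the quadratic term.\<close>
  have "vertices P \<subseteq> {x. (C - z) \<bullet> x = ((norm (v - z))\<^sup>2 - R\<^sup>2 + C \<bullet> C - z \<bullet> z) / 2}"
  proof
    fix w assume w: "w \<in> vertices P"
    have "(norm (w - C))\<^sup>2 = R\<^sup>2" using C w by (auto simp: dist_norm norm_minus_commute)
    moreover have "(norm (w - z))\<^sup>2 = (norm (v - z))\<^sup>2" using eq[OF w] by simp
    ultimately show "w \<in> {x. (C - z) \<bullet> x = ((norm (v - z))\<^sup>2 - R\<^sup>2 + C \<bullet> C - z \<bullet> z) / 2}"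
      by (simp add: power2_norm_eq_inner inner_diff_left inner_diff_right inner_commute)
  qed
  then have "C = z" using vertices_not_in_hyperplane[OF pP(1,2), of "C - z"]
    by (metis right_minus_eq)
  then show ?thesis using C assms(3) by (auto simp: z_def dist_norm norm_minus_commute)
qed

lemma platonic_sum_inner_squares:
  assumes P: "platonic_solid P" and R: "is_circumradius P R"
  shows "(\<Sum>v\<in>vertices P. ((v - centroid P) \<bullet> x)\<^sup>2) = real (card (vertices P)) * R\<^sup>2 / 3 * (x \<bullet> x)"
proof -
  define z where "z = centroid P"
  obtain c where c: "\<And>x. (\<Sum>v\<in>vertices P. ((v - z) \<bullet> x) *\<^sub>R (v - z)) = c *\<^sub>R x"
    using platonic_frame[OF P] unfolding z_def by blast
  have q: "(\<Sum>v\<in>vertices P. ((v - z) \<bullet> x)\<^sup>2) = c * (x \<bullet> x)" for x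
    using arg_cong[OF c[of x], of "\<lambda>y. y \<bullet> x"] by (simp add: inner_sum_left power2_eq_square)
  \<comment> \<open>Taking the trace over the standard basis determines \<open>c\<close>: each
    vertex contributes its squared distance from the centroid.\<close>
  have "3 * c = (\<Sum>b\<in>(Basis :: (real^3) set). c * (b \<bullet> b))" by simp
  also have "\<dots> = (\<Sum>b\<in>Basis. \<Sum>v\<in>vertices P. ((v - z) \<bullet> b)\<^sup>2)" by (simp only: q)
  also have "\<dots> = (\<Sum>v\<in>vertices P. \<Sum>b\<in>Basis. ((v - z) \<bullet> b)\<^sup>2)" by (rule sum.swap)
  also have "\<dots> = (\<Sum>v\<in>vertices P. (norm (v - z))\<^sup>2)"
    by (simp only: power2_norm_eq_inner power2_eq_square[of "_ \<bullet> _"] euclidean_inner[symmetric])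
  also have "\<dots> = real (card (vertices P)) * R\<^sup>2"
    using platonic_circumcenter[OF P R] by (simp add: z_def)
  finally show ?thesis using q[of x] by (simp add: z_def)
qed

section \<open>Power averages and the quadratic formula\<close>

text \<open>Since \<open>sqrt\<close> is also defined on negative reals, the nonnegativity of the
  radicand is asserted separately.\<close>

theorem theorem7p5:
  fixes P :: "(real^3) set" and n :: nat and A :: "nat \<Rightarrow> real^3"
    and M :: "real^3" and R L :: real
  assumes "platonic_solid P"
    and "n \<in> {4, 6, 8, 12, 20}"
    and "bij_betw A {1..n} (vertices P)"
    and "is_circumradius P R" and "R > 0"
    and "L = dist M (centroid P)"
  shows "0 \<le> 4 * (S_avg n A M 2)\<^sup>2 - 3 * S_avg n A M 4 \<and>
    ((R\<^sup>2 = 1/2 * (S_avg n A M 2 + sqrt (4 * (S_avg n A M 2)\<^sup>2 - 3 * S_avg n A M 4)) \<and>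
      L\<^sup>2 = 1/2 * (S_avg n A M 2 - sqrt (4 * (S_avg n A M 2)\<^sup>2 - 3 * S_avg n A M 4)))
     \<or>
     (R\<^sup>2 = 1/2 * (S_avg n A M 2 - sqrt (4 * (S_avg n A M 2)\<^sup>2 - 3 * S_avg n A M 4)) \<and>
      L\<^sup>2 = 1/2 * (S_avg n A M 2 + sqrt (4 * (S_avg n A M 2)\<^sup>2 - 3 * S_avg n A M 4))))"
proof -
  define z where "z = centroid P"
  define x where "x = M - z"
  define V where "V = vertices P"
  have n: "real n > 0" "card V = n"
    using assms(2) bij_betw_same_card[OF assms(3)] by (auto simp: V_def)
  have L: "x \<bullet> x = L\<^sup>2" using assms(6) by (simp add: x_def z_def dist_norm power2_norm_eq_inner)
  \<comment> \<open>Squared distances are affine in \<open>p v\<close>, so the two averages involve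
    only the first and second moments of \<open>p\<close> over the vertices.\<close>
  define p where "p v = (v - z) \<bullet> x" for v
  have d2: "(dist M v)\<^sup>2 = R\<^sup>2 + L\<^sup>2 - 2 * p v" if "v \<in> V" for v
  proof -
    have "(norm (v - z))\<^sup>2 = R\<^sup>2"
      using platonic_circumcenter[OF assms(1,4)] that by (simp add: V_def z_def)
    moreover have "dist M v = norm (x - (v - z))" by (simp add: x_def dist_norm)
    ultimately show ?thesis
      using L by (simp add: p_def power2_norm_eq_inner inner_diff_left inner_diff_right inner_commute)
  qed
  have d4: "dist M v ^ 4 = (R\<^sup>2 + L\<^sup>2)\<^sup>2 - 4 * (R\<^sup>2 + L\<^sup>2) * p v + 4 * (p v)\<^sup>2" if "v \<in> V" for v
  proof -
    have "dist M v ^ 4 = ((dist M v)\<^sup>2)\<^sup>2" by simp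
    also have "\<dots> = (R\<^sup>2 + L\<^sup>2)\<^sup>2 - 4 * (R\<^sup>2 + L\<^sup>2) * p v + 4 * (p v)\<^sup>2"
      unfolding d2[OF that] by (simp add: power2_eq_square algebra_simps)
    finally show ?thesis .
  qed
  \<comment> \<open>The first moment vanishes because \<open>z\<close> is the average of the
    vertices.\<close>
  have "(\<Sum>v\<in>V. v - z) = 0"
    using n by (simp only: sum_subtractf sum_constant_scaleR) (simp add: z_def centroid_def V_def)
  then have p1: "(\<Sum>v\<in>V. p v) = 0" by (simp add: p_def flip: inner_sum_left)
  have p2: "(\<Sum>v\<in>V. (p v)\<^sup>2) = n * R\<^sup>2 / 3 * L\<^sup>2"
    using platonic_sum_inner_squares[OF assms(1,4), of x] n L by (simp add: p_def V_def z_def)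
  have avg: "S_avg n A M k = (1 / real n) * (\<Sum>v\<in>V. dist M v ^ k)" for k
    unfolding S_avg_def V_def using sum.reindex_bij_betw[OF assms(3), of "\<lambda>v. dist M v ^ k"] by simp
  have "(\<Sum>v\<in>V. (dist M v)\<^sup>2) = n * (R\<^sup>2 + L\<^sup>2)"
    using n p1 by (simp add: d2 sum_subtractf flip: sum_distrib_left)
  then have S2: "S_avg n A M 2 = R\<^sup>2 + L\<^sup>2" using n by (simp add: avg)
  have "(\<Sum>v\<in>V. dist M v ^ 4) = n * (R\<^sup>2 + L\<^sup>2)\<^sup>2 + 4 * (n * R\<^sup>2 / 3 * L\<^sup>2)"
    using n p1 by (simp add: d4 sum.distrib sum_subtractf p2 del: mult_eq_0_iff flip: sum_distrib_left)
  also have "\<dots> = n * ((R\<^sup>2 + L\<^sup>2)\<^sup>2 + 4 / 3 * R\<^sup>2 * L\<^sup>2)" by (simp add: algebra_simps)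
  finally have S4: "S_avg n A M 4 = (R\<^sup>2 + L\<^sup>2)\<^sup>2 + 4 / 3 * R\<^sup>2 * L\<^sup>2" using n by (simp add: avg)
  have disc: "4 * (S_avg n A M 2)\<^sup>2 - 3 * S_avg n A M 4 = (R\<^sup>2 - L\<^sup>2)\<^sup>2"
    unfolding S2 S4 by (simp add: power2_eq_square algebra_simps)
  \<comment> \<open>The root is the absolute value of \<open>R\<^sup>2 - L\<^sup>2\<close>: the
    upper signs hold if this difference is nonnegative, the lower signs if it is negative.\<close>
  show ?thesis unfolding disc unfolding S2 by (auto simp: abs_if)
qed

end
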